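(* Let $F\in\mathfrak{F}_\hbar$ be r-holomorphic and assume that $$\Phi^1=(\mathbf{1}-\Lambda^2)F,\qquad \Phi^2=i(\mathbf{1}+\Lambda^2)F,\qquad \Phi^3=2\Lambda F$$ are integrable. Then $\vec{X}=(X^1,X^2,X^3)\in\mathfrak{F}_\hbar^3$, defined by $$X^i=x^i\mathbf{1}+\operatorname{Re}\int\Phi^i\,d\Lambda\qquad(i=1,2,3),$$ is a noncommutative minimal surface for arbitrary $x^1,x^2,x^3\in\mathbb{R}$.
   Context: Let $\hbar>0$ and let $\mathcal{A}_\hbar=\mathbb{C}\langle U,V\rangle/(UV-VU-i\hbar\mathbf{1})$ be the Weyl algebra (the unital associative complex algebra generated by $U,V$ with $[U,V]=i\hbar\mathbf{1}$). Let $\mathfrak{F}_\hbar$ be its skew field of fractions (Ore localization at all nonzero elements), whose elements can be written $AB^{-1}$ with $A,B\in\mathcal{A}_\hbar$, $B\ne0$. $\mathfrak{F}_\hbar$ is a $\ast$-algebra: $\ast$ is the conjugate-linear anti-multiplicative involution with $U^\ast=U$, $V^\ast=V$ (extended by $(A^{-1})^\ast=(A^\ast)^{-1}$). $A$ is hermitian if $A^\ast=A$; $\operatorname{Re}(A)=\frac12(A+A^\ast)$. Put $\Lambda=U+iV$ and, for $A\in\mathfrak{F}_\hbar$, $$\hat\partial_u(A)=\tfrac{1}{i\hbar}[A,V],\quad \hat\partial_v(A)=-\tfrac1{i\hbar}[A,U],\quad \partial(A)=\tfrac12(\hat\partial_u(A)-i\hat\partial_v(A)),\quad \bar\partial(A)=\tfrac12(\hat\partial_u(A)+i\hat\partial_v(A)).$$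 $A\in\mathfrak{F}_\hbar$ is r-holomorphic if $\bar\partial A=0$. If $A,B$ are r-holomorphic and $\partial B=A$, then $B$ is called a primitive element of $A$; $\int A\,d\Lambda$ denotes an arbitrary primitive element of $A$; an r-holomorphic $A$ that has at least one primitive element is called integrable. The Laplace operator is $\Delta_0(A)=\hat\partial_u^2(A)+\hat\partial_v^2(A)$. For $\vec{X},\vec{Y}\in\mathfrak{F}_\hbar^n$ set $\langle\vec{X},\vec{Y}\rangle=\frac12\sum_{i=1}^n(X^iY^i+Y^iX^i)$; derivations act on $\mathfrak{F}_\hbar^n$ componentwise, and $\vec X$ is hermitian if every component is. A hermitian $\vec{X}\in\mathfrak{F}_\hbar^n$ is a noncommutative minimal surface if $\Delta_0(X^i)=0$ for $i=1,\dots,n$, and $\mathcal{E}=\mathcal{G}$, $\mathcal{F}=0$, where $\mathcal{E}=\langle\hat\partial_u\vec{X},\hat\partial_u\vec{X}\rangle$, $\mathcal{G}=\langle\hat\partial_v\vec{X},\hat\partial_v\vec{X}\rangle$, $\mathcal{F}=\langle\hat\partial_u\vec{X},\hat\partial_v\vec{X}\rangle$. *)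

theory Defs
  imports "HOL-Analysis.Analysis" "HOL-Library.Poly_Mapping"
begin

section \<open>The free algebra on two generators\<close>

datatype generator = GenU | GenV

text \<open>Words under concatenation form a (noncommutative) monoid, written additively so that
  \<open>word \<Rightarrow>\<^sub>0 complex\<close> with its convolution product is the free unital complex algebra
  on \<open>GenU\<close> and \<open>GenV\<close>.\<close>

datatype word = Word (letters: "generator list")

instantiation word :: monoid_add
begin

definition zero_word :: word where
  "0 = Word []"

definition plus_word :: "word \<Rightarrow> word \<Rightarrow> word" where
  "v + w = Word (letters v @ letters w)"

instance
  by standard (simp_all add: zero_word_def plus_word_def)

end

type_synonym free_algebra = "word \<Rightarrow>\<^sub>0 complex"

definition free_U :: free_algebra where
  "free_U = Poly_Mapping.single (Word [GenU]) 1"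

definition free_V :: free_algebra where
  "free_V = Poly_Mapping.single (Word [GenV]) 1"

definition free_const :: "complex \<Rightarrow> free_algebra" where
  "free_const c = Poly_Mapping.single 0 c"

text \<open>The conjugate-linear anti-multiplicative involution fixing both generators: it reverses
  words and conjugates coefficients.\<close>

definition free_star :: "free_algebra \<Rightarrow> free_algebra" where
  "free_star a =
    Poly_Mapping.map_key (\<lambda>w. Word (rev (letters w))) (Poly_Mapping.map cnj a)"


section \<open>The Weyl algebra and its skew field of fractions\<close>

definition two_sided_ideal :: "'r::ring_1 set \<Rightarrow> bool" where
  "two_sided_ideal I \<longleftrightarrow>
    0 \<in> I \<and> (\<forall>a\<in>I. \<forall>b\<in>I. a + b \<in> I) \<and> (\<forall>a\<in>I. \<forall>r. r * a \<in> I \<and> a * r \<in> I)"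

definition weyl_ideal :: "real \<Rightarrow> free_algebra set" where
  "weyl_ideal hbar =
    two_sided_ideal hull
      {free_U * free_V - free_V * free_U - free_const (\<i> * of_real hbar)}"

text \<open>The Weyl algebra is the free algebra modulo \<open>weyl_ideal hbar\<close>. A skew field \<open>'f\<close>
  is its skew field of fractions (Ore localization at all nonzero elements) by way of an
  embedding of the Weyl algebra in \<open>'f\<close> such that every element of \<open>'f\<close> is a quotient of two
  elements of the image. This embedding is represented by its composite \<open>\<iota>\<close> with the quotient
  map from the free algebra, so that injectivity becomes the condition that the kernel is
  exactly \<open>weyl_ideal hbar\<close>. As an Ore localization, the pair \<open>('f, \<iota>)\<close> is determined by
  \<open>hbar\<close> up to unique isomorphism.\<close>

locale weyl_skew_field =
  fixes hbar :: real
    and \<iota> :: "free_algebra \<Rightarrow> 'f::division_ring"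
  assumes hbar_pos: "hbar > 0"
    and emb_one: "\<iota> 1 = 1"
    and emb_add: "\<iota> (a + b) = \<iota> a + \<iota> b"
    and emb_mult: "\<iota> (a * b) = \<iota> a * \<iota> b"
    and emb_kernel: "\<iota> a = 0 \<longleftrightarrow> a \<in> weyl_ideal hbar"
    and fractions: "\<exists>a b. \<iota> b \<noteq> 0 \<and> z = \<iota> a * inverse (\<iota> b)"

text \<open>The complex-algebra structure of \<open>'f\<close> is the one inherited from the Weyl algebra:
  \<open>scal \<iota> c\<close> is \<open>c\<close> times the unit, so \<open>scal \<iota> c * z\<close> is the scalar multiple of \<open>z\<close>.\<close>

definition scal :: "(free_algebra \<Rightarrow> 'f::division_ring) \<Rightarrow> complex \<Rightarrow> 'f" where
  "scal \<iota> c = \<iota> (free_const c)"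

text \<open>The extension of the involution to fractions: the star of a quotient of \<open>a\<close> by \<open>b\<close>
  is the inverse of the star of \<open>b\<close> times the star of \<open>a\<close>.\<close>

definition star :: "(free_algebra \<Rightarrow> 'f::division_ring) \<Rightarrow> 'f \<Rightarrow> 'f" where
  "star \<iota> z =
    (THE y. \<exists>a b. \<iota> b \<noteq> 0 \<and> z = \<iota> a * inverse (\<iota> b) \<and>
      y = inverse (\<iota> (free_star b)) * \<iota> (free_star a))"

definition hermitian :: "(free_algebra \<Rightarrow> 'f::division_ring) \<Rightarrow> 'f \<Rightarrow> bool" where
  "hermitian \<iota> z \<longleftrightarrow> star \<iota> z = z"

definition re_part :: "(free_algebra \<Rightarrow> 'f::division_ring) \<Rightarrow> 'f \<Rightarrow> 'f" where
  "re_part \<iota> z = scal \<iota> (1/2) * (z + star \<iota> z)"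


section \<open>Derivations and r-holomorphic elements\<close>

definition Lambda :: "(free_algebra \<Rightarrow> 'f::division_ring) \<Rightarrow> 'f" where
  "Lambda \<iota> = \<iota> free_U + scal \<iota> \<i> * \<iota> free_V"

definition d_u :: "real \<Rightarrow> (free_algebra \<Rightarrow> 'f::division_ring) \<Rightarrow> 'f \<Rightarrow> 'f" where
  "d_u hbar \<iota> z =
    scal \<iota> (1 / (\<i> * of_real hbar)) * (z * \<iota> free_V - \<iota> free_V * z)"

definition d_v :: "real \<Rightarrow> (free_algebra \<Rightarrow> 'f::division_ring) \<Rightarrow> 'f \<Rightarrow> 'f" where
  "d_v hbar \<iota> z =
    - (scal \<iota> (1 / (\<i> * of_real hbar)) * (z * \<iota> free_U - \<iota> free_U * z))"

definition d_hol :: "real \<Rightarrow> (free_algebra \<Rightarrow> 'f::division_ring) \<Rightarrow> 'f \<Rightarrow> 'f" where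
  "d_hol hbar \<iota> z = scal \<iota> (1/2) * (d_u hbar \<iota> z - scal \<iota> \<i> * d_v hbar \<iota> z)"

definition d_antihol :: "real \<Rightarrow> (free_algebra \<Rightarrow> 'f::division_ring) \<Rightarrow> 'f \<Rightarrow> 'f" where
  "d_antihol hbar \<iota> z = scal \<iota> (1/2) * (d_u hbar \<iota> z + scal \<iota> \<i> * d_v hbar \<iota> z)"

definition r_holomorphic :: "real \<Rightarrow> (free_algebra \<Rightarrow> 'f::division_ring) \<Rightarrow> 'f \<Rightarrow> bool" where
  "r_holomorphic hbar \<iota> z \<longleftrightarrow> d_antihol hbar \<iota> z = 0"

definition is_primitive ::
    "real \<Rightarrow> (free_algebra \<Rightarrow> 'f::division_ring) \<Rightarrow> 'f \<Rightarrow> 'f \<Rightarrow> bool" where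
  "is_primitive hbar \<iota> b a \<longleftrightarrow>
    r_holomorphic hbar \<iota> a \<and> r_holomorphic hbar \<iota> b \<and> d_hol hbar \<iota> b = a"

definition integrable_elt :: "real \<Rightarrow> (free_algebra \<Rightarrow> 'f::division_ring) \<Rightarrow> 'f \<Rightarrow> bool" where
  "integrable_elt hbar \<iota> a \<longleftrightarrow>
    r_holomorphic hbar \<iota> a \<and> (\<exists>b. is_primitive hbar \<iota> b a)"


section \<open>Noncommutative minimal surfaces\<close>

definition laplace :: "real \<Rightarrow> (free_algebra \<Rightarrow> 'f::division_ring) \<Rightarrow> 'f \<Rightarrow> 'f" where
  "laplace hbar \<iota> z = d_u hbar \<iota> (d_u hbar \<iota> z) + d_v hbar \<iota> (d_v hbar \<iota> z)"

definition sym_form ::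
    "(free_algebra \<Rightarrow> 'f::division_ring) \<Rightarrow> 'f ^ 'n \<Rightarrow> 'f ^ 'n \<Rightarrow> 'f" where
  "sym_form \<iota> X Y = scal \<iota> (1/2) * (\<Sum>i\<in>UNIV. X $ i * Y $ i + Y $ i * X $ i)"

definition vd_u :: "real \<Rightarrow> (free_algebra \<Rightarrow> 'f::division_ring) \<Rightarrow> 'f ^ 'n \<Rightarrow> 'f ^ 'n" where
  "vd_u hbar \<iota> X = (\<chi> i. d_u hbar \<iota> (X $ i))"

definition vd_v :: "real \<Rightarrow> (free_algebra \<Rightarrow> 'f::division_ring) \<Rightarrow> 'f ^ 'n \<Rightarrow> 'f ^ 'n" where
  "vd_v hbar \<iota> X = (\<chi> i. d_v hbar \<iota> (X $ i))"

definition nc_minimal_surface ::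
    "real \<Rightarrow> (free_algebra \<Rightarrow> 'f::division_ring) \<Rightarrow> 'f ^ 'n \<Rightarrow> bool" where
  "nc_minimal_surface hbar \<iota> X \<longleftrightarrow>
    (\<forall>i. hermitian \<iota> (X $ i)) \<and>
    (\<forall>i. laplace hbar \<iota> (X $ i) = 0) \<and>
    sym_form \<iota> (vd_u hbar \<iota> X) (vd_u hbar \<iota> X) = sym_form \<iota> (vd_v hbar \<iota> X) (vd_v hbar \<iota> X) \<and>
    sym_form \<iota> (vd_u hbar \<iota> X) (vd_v hbar \<iota> X) = 0"

end

theory Submission
  imports Defs
begin

text \<open>An element is r-holomorphic iff it commutes with \<open>\<Lambda>\<close>, so each \<open>\<Phi>\<^sup>i\<close> multiplies
  like a commutative Weierstrass datum and \<open>\<Sum>\<^sub>i (\<Phi>\<^sup>i)\<^sup>2 = 0\<close>. For primitives one has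
  \<open>\<partial>\<^sub>u X\<^sup>i = Re \<Phi>\<^sup>i\<close> and \<open>\<partial>\<^sub>v X\<^sup>i = Re (i \<Phi>\<^sup>i)\<close>. Although \<open>\<Phi>\<^sup>i\<close> and its adjoint need not
  commute, the mixed terms cancel in the symmetrized forms, leaving
  \<open>\<E> - \<G> = Re \<Sum>\<^sub>i (\<Phi>\<^sup>i)\<^sup>2\<close> and \<open>2\<F> = Re (i \<Sum>\<^sub>i (\<Phi>\<^sup>i)\<^sup>2)\<close>.\<close>

section \<open>The involution on the free algebra\<close>

text \<open>Updating at an absent key is the same as adding a single term. This reduces additive
  claims about the free algebra to monomials.\<close>

lemma poly_mapping_single_induct [case_names zero single add]:
  fixes p :: "'a \<Rightarrow>\<^sub>0 'b::monoid_add"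
  assumes "P 0"
    and "\<And>k v. P (Poly_Mapping.single k v)"
    and "\<And>p q. P p \<Longrightarrow> P q \<Longrightarrow> P (p + q)"
  shows "P p"
proof (induction p rule: update_induct)
  case const
  then show ?case using assms(1) by simp
next
  case (update p k v)
  then have "Poly_Mapping.update k v p = p + Poly_Mapping.single k v"
    by (intro poly_mapping_eqI)
      (auto simp: lookup_update lookup_add lookup_single when_def in_keys_iff)
  then show ?case using update assms by simp
qed

text \<open>\<open>map_key\<close> is composition with the key map only when that map is injective,
  which word reversal is. Linearity and involutivity can then be checked coefficientwise.\<close>

lemma lookup_free_star:
  "Poly_Mapping.lookup (free_star a) w = cnj (Poly_Mapping.lookup a (Word (rev (letters w))))"
proof -
  have "inj (\<lambda>w. Word (rev (letters w)))"
    by (auto intro!: injI simp: word.expand)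
  then show ?thesis
    by (simp add: free_star_def map_key.rep_eq map.rep_eq when_def)
qed

lemma free_star_add: "free_star (a + b) = free_star a + free_star b"
  by (rule poly_mapping_eqI) (simp add: lookup_free_star lookup_add)

lemma free_star_0 [simp]: "free_star 0 = 0"
  by (rule poly_mapping_eqI) (simp add: lookup_free_star)

lemma free_star_diff: "free_star (a - b) = free_star a - free_star b"
  by (rule poly_mapping_eqI) (simp add: lookup_free_star lookup_minus)

lemma free_star_involutive [simp]: "free_star (free_star a) = a"
  by (rule poly_mapping_eqI) (simp add: lookup_free_star)

lemma free_star_single:
  "free_star (Poly_Mapping.single w c) = Poly_Mapping.single (Word (rev (letters w))) (cnj c)"
  by (rule poly_mapping_eqI) (auto simp: lookup_free_star lookup_single when_def)

text \<open>Both sides are additive in each argument, so two monomials suffice; there reversal swaps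
  the concatenated words and the complex coefficients commute.\<close>

lemma free_star_mult: "free_star (a * b) = free_star b * free_star a"
proof (induction a rule: poly_mapping_single_induct)
  case zero
  show ?case by simp
next
  case (single w c)
  show ?case
  proof (induction b rule: poly_mapping_single_induct)
    case zero
    show ?case by simp
  next
    case (single v d)
    show ?case
      by (simp add: mult_single free_star_single plus_word_def mult.commute)
  next
    case (add b b')
    then show ?case by (simp add: free_star_add algebra_simps)
  qed
next
  case (add a a')
  then show ?case by (simp add: free_star_add algebra_simps)
qed

lemma free_star_const [simp]: "free_star (free_const c) = free_const (cnj c)"
  by (simp add: free_const_def free_star_single zero_word_def)

lemma free_star_U [simp]: "free_star free_U = free_U"
  and free_star_V [simp]: "free_star free_V = free_V"
  by (simp_all add: free_U_def free_V_def free_star_single)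

lemma free_const_1: "free_const 1 = 1"
  by (simp add: free_const_def)

lemma free_const_commute: "free_const c * a = a * free_const c"
proof (induction a rule: poly_mapping_single_induct)
  case zero
  show ?case by simp
next
  case (single w d)
  show ?case by (simp add: free_const_def mult_single mult.commute)
next
  case (add a b)
  then show ?case by (simp add: algebra_simps)
qed


context weyl_skew_field
begin

section \<open>The embedding and the central scalars\<close>

lemma emb_zero [simp]: "\<iota> 0 = 0"
  using emb_add[of 0 0] by simp

lemma emb_uminus: "\<iota> (- a) = - \<iota> a"
  using emb_add[of a "- a"] by (simp add: eq_neg_iff_add_eq_0 add.commute)

lemma emb_diff: "\<iota> (a - b) = \<iota> a - \<iota> b"
  using emb_add[of a "- b"] by (simp add: emb_uminus)

lemma scal_1 [simp]: "scal \<iota> 1 = 1"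
  by (simp add: scal_def free_const_1 emb_one)

lemma scal_add: "scal \<iota> (c + d) = scal \<iota> c + scal \<iota> d"
  by (simp add: scal_def free_const_def single_add emb_add)

lemma scal_uminus: "scal \<iota> (- c) = - scal \<iota> c"
  by (simp add: scal_def free_const_def single_uminus emb_uminus)

lemma scal_mult: "scal \<iota> c * scal \<iota> d = scal \<iota> (c * d)"
  by (simp add: scal_def free_const_def emb_mult[symmetric] mult_single)

text \<open>Constants are central in the free algebra. Commuting with a nonzero denominator implies
  commuting with its inverse, so centrality passes to all fractions.\<close>

lemma scal_commute: "scal \<iota> c * z = z * scal \<iota> c"
proof -
  have *: "scal \<iota> c * \<iota> a = \<iota> a * scal \<iota> c" for a
    by (simp add: scal_def emb_mult[symmetric] free_const_commute)
  obtain a b where z: "\<iota> b \<noteq> 0" "z = \<iota> a * inverse (\<iota> b)"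
    using fractions by blast
  have "scal \<iota> c * inverse (\<iota> b) = inverse (\<iota> b) * scal \<iota> c"
    using *[of b] by (metis mult_commute_imp_mult_inverse_commute)
  then show ?thesis
    using *[of a] z(2) by (metis mult.assoc)
qed

lemma scal_left_commute: "z * (scal \<iota> c * w) = scal \<iota> c * (z * w)"
  by (metis mult.assoc scal_commute)

lemma scal_mult_mult: "(scal \<iota> c * z) * (scal \<iota> d * w) = scal \<iota> (c * d) * (z * w)"
  by (simp add: mult.assoc scal_left_commute[of z] scal_mult[symmetric])

lemma scal_double: "scal \<iota> c * (z + z) = scal \<iota> (2 * c) * z"
proof -
  have "scal \<iota> (2 * c) = scal \<iota> c + scal \<iota> c"
    by (simp add: scal_add[symmetric])
  then show ?thesis by (simp add: distrib_left distrib_right)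
qed

lemma scal_half_double: "scal \<iota> (1/2) * (z + z) = z"
  by (simp add: scal_double)

lemma scal_ii: "scal \<iota> \<i> * (scal \<iota> \<i> * z) = - z"
  by (simp add: mult.assoc[symmetric] scal_mult scal_uminus)

section \<open>Descent of the involution to the Weyl algebra and extension to fractions\<close>

text \<open>The kernel is a hull, so it suffices that the elements whose star is killed by
  \<open>\<iota>\<close> form a two-sided ideal containing the defining relation.\<close>

lemma emb_free_star_eq_0:
  assumes "\<iota> a = 0"
  shows "\<iota> (free_star a) = 0"
proof -
  have "a \<in> weyl_ideal hbar"
    using assms emb_kernel by blast
  then show ?thesis
    unfolding weyl_ideal_def
  proof (rule hull_induct)
    let ?g = "free_U * free_V - free_V * free_U - free_const (\<i> * of_real hbar)"
    fix x assume x: "x \<in> {?g}"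
    have "\<iota> ?g = 0"
      unfolding emb_kernel weyl_ideal_def by (rule hull_inc) simp
    moreover have "free_const (- c) = - free_const c" for c
      by (simp add: free_const_def single_uminus)
    \<comment> \<open>The star exchanges \<open>free_U * free_V\<close> and
      \<open>free_V * free_U\<close>, and conjugation negates the purely imaginary constant.\<close>
    then have "free_star ?g = - ?g"
      by (simp add: free_star_diff free_star_mult)
    ultimately show "\<iota> (free_star x) = 0"
      using x by (simp only: emb_uminus singleton_iff neg_equal_0_iff_equal)
  next
    \<comment> \<open>The star turns left multiples into right multiples, which is harmless because
      the ideal is two-sided.\<close>
    show "two_sided_ideal {x. \<iota> (free_star x) = 0}"
      by (simp add: two_sided_ideal_def free_star_add free_star_mult emb_add emb_mult)
  qed
qed

lemma emb_free_star_eq_0_iff: "\<iota> (free_star a) = 0 \<longleftrightarrow> \<iota> a = 0"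
  using emb_free_star_eq_0[of a] emb_free_star_eq_0[of "free_star a"] by auto

lemma emb_free_star_cong:
  assumes "\<iota> a = \<iota> b"
  shows "\<iota> (free_star a) = \<iota> (free_star b)"
  using emb_free_star_eq_0[of "a - b"] assms by (simp add: emb_diff free_star_diff)

text \<open>The Ore condition is read off from \<open>fractions\<close>: rewrite the left quotient
  of \<open>d\<close> by \<open>b\<close> as a right quotient of \<open>e\<close> by
  \<open>f\<close> and clear denominators.\<close>

lemma right_ore:
  assumes "\<iota> b \<noteq> 0"
  obtains e f where "\<iota> f \<noteq> 0" and "\<iota> (b * e) = \<iota> (d * f)"
proof -
  obtain e f where f: "\<iota> f \<noteq> 0" and "inverse (\<iota> b) * \<iota> d = \<iota> e * inverse (\<iota> f)"
    using fractions by blast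
  then have "\<iota> b * (\<iota> e * inverse (\<iota> f)) * \<iota> f = \<iota> b * (inverse (\<iota> b) * \<iota> d) * \<iota> f"
    by simp
  moreover have "\<iota> b * (\<iota> e * inverse (\<iota> f)) * \<iota> f = \<iota> (b * e)"
    using f by (simp add: emb_mult mult.assoc)
  moreover have "\<iota> b * (inverse (\<iota> b) * \<iota> d) * \<iota> f = \<iota> (d * f)"
    using assms by (simp add: emb_mult mult.assoc[symmetric])
  ultimately have "\<iota> (b * e) = \<iota> (d * f)"
    by simp
  with f show ?thesis using that by blast
qed

text \<open>This makes the definite description in \<open>star\<close> well defined. Both fractions
  are expanded to the common denominator \<open>b * e\<close>, equal in the image to
  \<open>d * f\<close>; starring the resulting equations leaves common left factors that
  cancel.\<close>

lemma star_fraction_unique: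
  assumes b: "\<iota> b \<noteq> 0" and d: "\<iota> d \<noteq> 0"
    and eq: "\<iota> a * inverse (\<iota> b) = \<iota> c * inverse (\<iota> d)"
  shows "inverse (\<iota> (free_star b)) * \<iota> (free_star a) =
    inverse (\<iota> (free_star d)) * \<iota> (free_star c)"
proof -
  obtain e f where f: "\<iota> f \<noteq> 0" and bd: "\<iota> (b * e) = \<iota> (d * f)"
    using right_ore[OF b] by blast
  have "\<iota> (a * e) = \<iota> a * inverse (\<iota> b) * \<iota> (b * e)"
    using b by (simp add: emb_mult mult.assoc) (simp add: mult.assoc[symmetric])
  also have "\<dots> = \<iota> c * inverse (\<iota> d) * \<iota> (d * f)"
    by (simp only: eq bd)
  also have "\<dots> = \<iota> (c * f)"
    using d by (simp add: emb_mult mult.assoc) (simp add: mult.assoc[symmetric])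
  finally have ac: "\<iota> (a * e) = \<iota> (c * f)" .
  let ?s = "\<lambda>a. \<iota> (free_star a)"
  have ac': "?s e * ?s a = ?s f * ?s c" and bd': "?s e * ?s b = ?s f * ?s d"
    using emb_free_star_cong[OF ac] emb_free_star_cong[OF bd]
    by (simp_all add: free_star_mult emb_mult)
  have nz: "?s b \<noteq> 0" "?s d \<noteq> 0" "?s f \<noteq> 0"
    using b d f by (simp_all add: emb_free_star_eq_0_iff)
  then have e: "?s e \<noteq> 0" using bd' by auto
  have "inverse (?s b) * ?s a = inverse (?s e * ?s b) * (?s e * ?s a)"
    using nz e by (simp add: nonzero_inverse_mult_distrib mult.assoc) (simp add: mult.assoc[symmetric])
  also have "\<dots> = inverse (?s f * ?s d) * (?s f * ?s c)"
    by (simp only: ac' bd')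
  also have "\<dots> = inverse (?s d) * ?s c"
    using nz by (simp add: nonzero_inverse_mult_distrib mult.assoc) (simp add: mult.assoc[symmetric])
  finally show ?thesis .
qed

lemma star_fraction:
  assumes "\<iota> b \<noteq> 0"
  shows "star \<iota> (\<iota> a * inverse (\<iota> b)) = inverse (\<iota> (free_star b)) * \<iota> (free_star a)"
  unfolding star_def
proof (rule the_equality)
  fix y
  assume "\<exists>c d. \<iota> d \<noteq> 0 \<and> \<iota> a * inverse (\<iota> b) = \<iota> c * inverse (\<iota> d) \<and>
    y = inverse (\<iota> (free_star d)) * \<iota> (free_star c)"
  then obtain c d where "\<iota> d \<noteq> 0" "\<iota> a * inverse (\<iota> b) = \<iota> c * inverse (\<iota> d)"
    "y = inverse (\<iota> (free_star d)) * \<iota> (free_star c)"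
    by (elim exE conjE)
  then show "y = inverse (\<iota> (free_star b)) * \<iota> (free_star a)"
    using star_fraction_unique[OF assms, of d a c] by simp
qed (use assms in blast)

lemma star_emb: "star \<iota> (\<iota> a) = \<iota> (free_star a)"
proof -
  have "free_star 1 = 1"
    using free_star_const[of 1] by (simp add: free_const_1)
  then show ?thesis
    using star_fraction[of 1 a] by (simp add: emb_one)
qed

lemma star_scal [simp]: "star \<iota> (scal \<iota> c) = scal \<iota> (cnj c)"
  by (simp add: scal_def star_emb)

text \<open>The inner quotient of \<open>c\<close> by \<open>b\<close> is moved to the other side by
  the Ore condition, which makes the product a single fraction; after starring, the same relation
  moves it back.\<close>

lemma star_mult: "star \<iota> (z * w) = star \<iota> w * star \<iota> z"
proof -
  obtain a b where b: "\<iota> b \<noteq> 0" and z: "z = \<iota> a * inverse (\<iota> b)"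
    using fractions by blast
  obtain c d where d: "\<iota> d \<noteq> 0" and w: "w = \<iota> c * inverse (\<iota> d)"
    using fractions by blast
  obtain e f where f: "\<iota> f \<noteq> 0" and bc: "\<iota> (b * e) = \<iota> (c * f)"
    using right_ore[OF b] by blast
  have "\<iota> e * inverse (\<iota> f) = inverse (\<iota> b) * \<iota> (b * e) * inverse (\<iota> f)"
    using b by (simp add: emb_mult mult.assoc[symmetric])
  also have "\<dots> = inverse (\<iota> b) * \<iota> c"
    unfolding bc using f by (simp add: emb_mult mult.assoc)
  finally have cb: "inverse (\<iota> b) * \<iota> c = \<iota> e * inverse (\<iota> f)" by simp
  have "z * w = \<iota> a * (inverse (\<iota> b) * \<iota> c) * inverse (\<iota> d)"
    by (simp add: z w mult.assoc)
  also have "\<dots> = \<iota> (a * e) * inverse (\<iota> (d * f))"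
    unfolding cb using d f by (simp add: emb_mult nonzero_inverse_mult_distrib mult.assoc)
  finally have "z * w = \<iota> (a * e) * inverse (\<iota> (d * f))" .
  moreover have "\<iota> (d * f) \<noteq> 0"
    using d f by (simp add: emb_mult)
  ultimately have zw: "star \<iota> (z * w) = inverse (\<iota> (free_star (d * f))) * \<iota> (free_star (a * e))"
    by (simp add: star_fraction)
  let ?s = "\<lambda>a. \<iota> (free_star a)"
  have bc': "?s e * ?s b = ?s f * ?s c"
    using emb_free_star_cong[OF bc] by (simp add: free_star_mult emb_mult)
  have nz: "?s b \<noteq> 0" "?s d \<noteq> 0" "?s f \<noteq> 0"
    using b d f by (simp_all add: emb_free_star_eq_0_iff)
  \<comment> \<open>This is the starred form of \<open>cb\<close>, derived from the free-algebra
    relation \<open>bc'\<close> because multiplicativity of \<open>star\<close> is still being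
    proved.\<close>
  have "inverse (?s f) * ?s e = inverse (?s f) * (?s e * ?s b) * inverse (?s b)"
    using nz by (simp add: mult.assoc)
  also have "\<dots> = ?s c * inverse (?s b)"
    unfolding bc' using nz by (simp add: mult.assoc[symmetric])
  finally have swap: "inverse (?s f) * ?s e = ?s c * inverse (?s b)" .
  have "star \<iota> (z * w) = inverse (?s d) * (inverse (?s f) * ?s e) * ?s a"
    using nz by (simp add: zw free_star_mult emb_mult nonzero_inverse_mult_distrib mult.assoc)
  also have "\<dots> = star \<iota> w * star \<iota> z"
    unfolding swap using b d by (simp add: z w star_fraction mult.assoc)
  finally show ?thesis .
qed

text \<open>Over the common denominator \<open>d * f\<close> the claim reduces to additivity of
  \<open>free_star\<close> on numerators.\<close>

lemma star_add: "star \<iota> (z + w) = star \<iota> z + star \<iota> w"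
proof -
  obtain a b where b: "\<iota> b \<noteq> 0" and z: "z = \<iota> a * inverse (\<iota> b)"
    using fractions by blast
  obtain c d where d: "\<iota> d \<noteq> 0" and w: "w = \<iota> c * inverse (\<iota> d)"
    using fractions by blast
  obtain e f where f: "\<iota> f \<noteq> 0" and bd: "\<iota> (b * e) = \<iota> (d * f)"
    using right_ore[OF b] by blast
  have df: "\<iota> (d * f) \<noteq> 0"
    using d f by (simp add: emb_mult)
  then have e: "\<iota> e \<noteq> 0"
    unfolding bd[symmetric] by (auto simp: emb_mult)
  have z': "z = \<iota> (a * e) * inverse (\<iota> (d * f))"
    unfolding bd[symmetric] using b e
    by (simp add: z emb_mult nonzero_inverse_mult_distrib mult.assoc) (simp add: mult.assoc[symmetric])
  have w': "w = \<iota> (c * f) * inverse (\<iota> (d * f))"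
    using d f
    by (simp add: w emb_mult nonzero_inverse_mult_distrib mult.assoc) (simp add: mult.assoc[symmetric])
  have "z + w = \<iota> (a * e + c * f) * inverse (\<iota> (d * f))"
    by (simp add: z' w' emb_add distrib_right)
  then have "star \<iota> (z + w) =
      inverse (\<iota> (free_star (d * f))) * \<iota> (free_star (a * e + c * f))"
    using df by (simp add: star_fraction)
  then show ?thesis
    using df by (simp add: z' w' star_fraction free_star_add emb_add distrib_left)
qed

lemma star_0 [simp]: "star \<iota> 0 = 0"
  using star_add[of 0 0] by simp

lemma star_uminus: "star \<iota> (- z) = - star \<iota> z"
  using star_add[of z "- z"] by (simp add: eq_neg_iff_add_eq_0 add.commute)

lemma star_diff: "star \<iota> (z - w) = star \<iota> z - star \<iota> w"
  using star_add[of z "- w"] by (simp add: star_uminus)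

text \<open>The double star is multiplicative and fixes the image of \<open>\<iota>\<close>, so
  multiplying by the denominator reduces the claim to numerators.\<close>

lemma star_involutive [simp]: "star \<iota> (star \<iota> z) = z"
proof -
  obtain a b where b: "\<iota> b \<noteq> 0" and z: "z = \<iota> a * inverse (\<iota> b)"
    using fractions by blast
  then have zb: "z * \<iota> b = \<iota> a"
    by (simp add: mult.assoc)
  have "star \<iota> (star \<iota> z) * \<iota> b = star \<iota> (star \<iota> (z * \<iota> b))"
    by (simp add: star_mult star_emb)
  also have "\<dots> = z * \<iota> b"
    by (simp add: zb star_emb)
  finally show ?thesis
    using b by simp
qed

section \<open>Real parts and derivations\<close>

lemma re_part_add: "re_part \<iota> (z + w) = re_part \<iota> z + re_part \<iota> w"
  by (simp add: re_part_def star_add algebra_simps)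

lemma re_part_0 [simp]: "re_part \<iota> 0 = 0"
  by (simp add: re_part_def)

lemma hermitian_re_part: "hermitian \<iota> (re_part \<iota> z)"
  by (simp add: hermitian_def re_part_def star_mult star_add add.commute
      scal_commute[of "1/2", symmetric])

lemma d_u_add: "d_u hbar \<iota> (z + w) = d_u hbar \<iota> z + d_u hbar \<iota> w"
  by (simp add: d_u_def algebra_simps)

lemma d_v_add: "d_v hbar \<iota> (z + w) = d_v hbar \<iota> z + d_v hbar \<iota> w"
  by (simp add: d_v_def algebra_simps)

lemma d_u_scal [simp]: "d_u hbar \<iota> (scal \<iota> c) = 0"
  by (simp add: d_u_def scal_commute[of c])

lemma d_v_scal [simp]: "d_v hbar \<iota> (scal \<iota> c) = 0"
  by (simp add: d_v_def scal_commute[of c])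

lemma d_u_scal_mult: "d_u hbar \<iota> (scal \<iota> c * z) = scal \<iota> c * d_u hbar \<iota> z"
  by (simp add: d_u_def mult.assoc scal_left_commute[of "\<iota> free_V"]
      scal_left_commute[of "scal \<iota> (1 / (\<i> * of_real hbar))" c] right_diff_distrib[symmetric])

lemma d_v_scal_mult: "d_v hbar \<iota> (scal \<iota> c * z) = scal \<iota> c * d_v hbar \<iota> z"
  by (simp add: d_v_def mult.assoc scal_left_commute[of "\<iota> free_U"]
      scal_left_commute[of "scal \<iota> (1 / (\<i> * of_real hbar))" c] right_diff_distrib[symmetric])

text \<open>Reversing the commutator and conjugating the imaginary prefactor each contribute a sign,
  and the two signs cancel.\<close>

lemma d_u_star: "d_u hbar \<iota> (star \<iota> z) = star \<iota> (d_u hbar \<iota> z)"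
  by (simp add: d_u_def star_mult star_diff star_emb scal_uminus left_diff_distrib
      right_diff_distrib scal_commute[of "1 / (\<i> * of_real hbar)", symmetric])

lemma d_v_star: "d_v hbar \<iota> (star \<iota> z) = star \<iota> (d_v hbar \<iota> z)"
  by (simp add: d_v_def star_mult star_diff star_uminus star_emb scal_uminus left_diff_distrib
      right_diff_distrib scal_commute[of "1 / (\<i> * of_real hbar)", symmetric])

lemma d_u_re_part: "d_u hbar \<iota> (re_part \<iota> z) = re_part \<iota> (d_u hbar \<iota> z)"
  by (simp add: re_part_def d_u_scal_mult d_u_add d_u_star)

lemma d_v_re_part: "d_v hbar \<iota> (re_part \<iota> z) = re_part \<iota> (d_v hbar \<iota> z)"
  by (simp add: re_part_def d_v_scal_mult d_v_add d_v_star)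

section \<open>r-holomorphic elements and primitives\<close>

lemma r_holomorphic_iff:
  "r_holomorphic hbar \<iota> z \<longleftrightarrow> d_u hbar \<iota> z + scal \<iota> \<i> * d_v hbar \<iota> z = 0"
proof -
  have "scal \<iota> (1/2) \<noteq> 0"
    using scal_half_double[of 1] by auto
  then show ?thesis
    by (simp add: r_holomorphic_def d_antihol_def)
qed

text \<open>Up to a nonzero scalar, \<open>d_antihol\<close> is the commutator with
  \<open>Lambda \<iota>\<close>.\<close>

lemma r_holomorphic_commutes_Lambda:
  assumes "r_holomorphic hbar \<iota> z"
  shows "z * Lambda \<iota> = Lambda \<iota> * z"
proof -
  let ?k = "scal \<iota> (1 / (\<i> * of_real hbar))"
  \<comment> \<open>The factor \<open>\<i>\<close> turns the holomorphy equation into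
    \<open>?k\<close> times the commutator of \<open>z\<close> with
    \<open>Lambda \<iota>\<close>.\<close>
  have "scal \<iota> \<i> * (d_u hbar \<iota> z + scal \<iota> \<i> * d_v hbar \<iota> z) = 0"
    using assms by (simp add: r_holomorphic_iff)
  then have "scal \<iota> \<i> * d_u hbar \<iota> z - d_v hbar \<iota> z = 0"
    by (simp add: distrib_left scal_ii)
  moreover have "z * Lambda \<iota> - Lambda \<iota> * z =
      (z * \<iota> free_U - \<iota> free_U * z) + scal \<iota> \<i> * (z * \<iota> free_V - \<iota> free_V * z)"
    by (simp add: Lambda_def distrib_left distrib_right right_diff_distrib scal_left_commute[of z]
        mult.assoc)
  ultimately have "?k * (z * Lambda \<iota> - Lambda \<iota> * z) = 0"
    by (simp add: d_u_def d_v_def distrib_left scal_left_commute[of ?k \<i>] add.commute)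
  moreover have "?k * scal \<iota> (\<i> * of_real hbar) = 1"
    using hbar_pos by (simp add: scal_mult)
  then have "?k \<noteq> 0" by auto
  ultimately show ?thesis by simp
qed

text \<open>The Cauchy-Riemann equation, obtained by multiplying the holomorphy condition by
  \<open>\<i>\<close>.\<close>

lemma primitive_d_v:
  assumes "is_primitive hbar \<iota> b a"
  shows "d_v hbar \<iota> b = scal \<iota> \<i> * d_u hbar \<iota> b"
proof -
  have "scal \<iota> \<i> * (d_u hbar \<iota> b + scal \<iota> \<i> * d_v hbar \<iota> b) = 0"
    using assms by (simp add: is_primitive_def r_holomorphic_iff)
  then show ?thesis
    by (simp add: distrib_left scal_ii)
qed

text \<open>By the Cauchy-Riemann equation both halves of \<open>d_hol\<close> equal half of
  \<open>d_u\<close>.\<close>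

lemma primitive_d_u:
  assumes "is_primitive hbar \<iota> b a"
  shows "d_u hbar \<iota> b = a"
proof -
  have "d_hol hbar \<iota> b = a"
    using assms by (simp add: is_primitive_def)
  then show ?thesis
    by (simp add: d_hol_def primitive_d_v[OF assms] scal_ii scal_half_double)
qed

section \<open>Quadratic identities for real parts\<close>

lemma re_part_ii: "re_part \<iota> (scal \<iota> \<i> * z) = scal \<iota> (\<i>/2) * (z - star \<iota> z)"
proof -
  have "scal \<iota> \<i> * z + star \<iota> (scal \<iota> \<i> * z) = scal \<iota> \<i> * (z - star \<iota> z)"
    by (simp add: star_mult scal_uminus scal_commute[of \<i>, symmetric] right_diff_distrib)
  then show ?thesis
    by (simp add: re_part_def mult.assoc[symmetric] scal_mult)
qed

text \<open>The square of \<open>\<i>/2\<close> is -1/4, so the difference becomes a sum of squares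
  of \<open>z + ?w\<close> and \<open>z - ?w\<close>, in which \<open>z * ?w\<close> and
  \<open>?w * z\<close> cancel separately.\<close>

lemma re_part_square_diff:
  "re_part \<iota> z * re_part \<iota> z - re_part \<iota> (scal \<iota> \<i> * z) * re_part \<iota> (scal \<iota> \<i> * z) =
    re_part \<iota> (z * z)"
proof -
  let ?w = "star \<iota> z"
  have "re_part \<iota> z * re_part \<iota> z - re_part \<iota> (scal \<iota> \<i> * z) * re_part \<iota> (scal \<iota> \<i> * z) =
      scal \<iota> (1/4) * ((z + ?w) * (z + ?w) + (z - ?w) * (z - ?w))"
    unfolding re_part_ii re_part_def[of \<iota> z] scal_mult_mult
    by (simp add: scal_uminus distrib_left[of "scal \<iota> (1/4)"])
  also have "(z + ?w) * (z + ?w) + (z - ?w) * (z - ?w) =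
      (z * z + ?w * ?w) + (z * z + ?w * ?w)"
    by (simp add: algebra_simps)
  finally show ?thesis
    by (simp only: scal_double) (simp add: re_part_def star_mult)
qed

text \<open>One order of the factors alone would leave the commutator of \<open>?w\<close> and
  \<open>z\<close>; adding the other order removes it.\<close>

lemma re_part_anticommutator:
  "re_part \<iota> z * re_part \<iota> (scal \<iota> \<i> * z) + re_part \<iota> (scal \<iota> \<i> * z) * re_part \<iota> z =
    re_part \<iota> (scal \<iota> \<i> * (z * z))"
proof -
  let ?w = "star \<iota> z"
  have "re_part \<iota> z * re_part \<iota> (scal \<iota> \<i> * z) + re_part \<iota> (scal \<iota> \<i> * z) * re_part \<iota> z =
      scal \<iota> (\<i>/4) * ((z + ?w) * (z - ?w) + (z - ?w) * (z + ?w))"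
    unfolding re_part_ii re_part_def[of \<iota> z] scal_mult_mult
    by (simp add: distrib_left[of "scal \<iota> (\<i>/4)"])
  also have "(z + ?w) * (z - ?w) + (z - ?w) * (z + ?w) =
      (z * z - ?w * ?w) + (z * z - ?w * ?w)"
    by (simp add: algebra_simps)
  finally show ?thesis
    unfolding re_part_ii by (simp only: scal_double) (simp add: star_mult)
qed

lemma re_part_sum: "re_part \<iota> (\<Sum>i\<in>A. f i) = (\<Sum>i\<in>A. re_part \<iota> (f i))"
  by (induction A rule: infinite_finite_induct) (simp_all add: re_part_add)

section \<open>The Weierstrass representation\<close>

text \<open>The general form in any finite dimension: only isotropy of \<open>\<Phi>\<close> enters,
  not its Weierstrass shape. The translation has complex entries because \<open>scal\<close> takes
  complex numbers; their reality makes it hermitian.\<close>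

lemma nc_minimal_surface_re_part_primitive:
  fixes P \<Phi> :: "'f ^ 'n" and x :: "complex ^ 'n"
  assumes x: "\<And>i. x $ i \<in> \<real>"
    and P: "\<And>i. is_primitive hbar \<iota> (P $ i) (\<Phi> $ i)"
    and isotropic: "(\<Sum>i\<in>UNIV. \<Phi> $ i * \<Phi> $ i) = 0"
  shows "nc_minimal_surface hbar \<iota> (\<chi> i. scal \<iota> (x $ i) + re_part \<iota> (P $ i))"
proof -
  let ?X = "\<chi> i. scal \<iota> (x $ i) + re_part \<iota> (P $ i)"
  have u: "d_u hbar \<iota> (?X $ i) = re_part \<iota> (\<Phi> $ i)" for i
    by (simp add: d_u_add d_u_re_part primitive_d_u[OF P])
  have v: "d_v hbar \<iota> (?X $ i) = re_part \<iota> (scal \<iota> \<i> * \<Phi> $ i)" for i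
    by (simp add: d_v_add d_v_re_part primitive_d_v[OF P] primitive_d_u[OF P])
  have "hermitian \<iota> (?X $ i)" for i
    using hermitian_re_part[of "P $ i"] x[of i] by (simp add: hermitian_def star_add Reals_cnj_iff)
  moreover have "laplace hbar \<iota> (?X $ i) = 0" for i
  proof -
    \<comment> \<open>This is holomorphy of \<open>\<Phi> $ i\<close> itself; the Laplacian is the
      real part of this expression.\<close>
    have "d_u hbar \<iota> (\<Phi> $ i) + d_v hbar \<iota> (scal \<iota> \<i> * \<Phi> $ i) = 0"
      using P[of i] by (simp add: is_primitive_def r_holomorphic_iff d_v_scal_mult)
    then show ?thesis
      unfolding laplace_def u v d_u_re_part d_v_re_part by (simp add: re_part_add[symmetric])
  qed
  moreover have "(\<Sum>i\<in>UNIV. re_part \<iota> (\<Phi> $ i) * re_part \<iota> (\<Phi> $ i)) =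
      (\<Sum>i\<in>UNIV. re_part \<iota> (scal \<iota> \<i> * \<Phi> $ i) * re_part \<iota> (scal \<iota> \<i> * \<Phi> $ i))"
  proof -
    \<comment> \<open>Each summand is the real part of a square, so the sum is the real part of the
      isotropy sum.\<close>
    have "(\<Sum>i\<in>UNIV. re_part \<iota> (\<Phi> $ i) * re_part \<iota> (\<Phi> $ i) -
        re_part \<iota> (scal \<iota> \<i> * \<Phi> $ i) * re_part \<iota> (scal \<iota> \<i> * \<Phi> $ i)) = 0"
      by (simp add: re_part_square_diff re_part_sum[symmetric] isotropic)
    then show ?thesis by (simp add: sum_subtractf)
  qed
  then have "sym_form \<iota> (vd_u hbar \<iota> ?X) (vd_u hbar \<iota> ?X) =
      sym_form \<iota> (vd_v hbar \<iota> ?X) (vd_v hbar \<iota> ?X)"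
    unfolding sym_form_def vd_u_def vd_v_def vec_lambda_beta u[simplified] v[simplified]
    by (simp add: sum.distrib)
  moreover have "sym_form \<iota> (vd_u hbar \<iota> ?X) (vd_v hbar \<iota> ?X) = 0"
    unfolding sym_form_def vd_u_def vd_v_def vec_lambda_beta u[simplified] v[simplified]
    by (simp add: re_part_anticommutator re_part_sum[symmetric] sum_distrib_left[symmetric]
        isotropic)
  ultimately show ?thesis
    unfolding nc_minimal_surface_def by blast
qed

text \<open>Once \<open>F\<close> is moved past \<open>L\<close>, every square is a polynomial in
  \<open>L\<close> times \<open>F * F\<close>, and the polynomials satisfy
  \<open>(1 - L^2)^2 - (1 + L^2)^2 + 4 L^2 = 0\<close>.\<close>

lemma weierstrass_isotropic:
  assumes "r_holomorphic hbar \<iota> F"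
  defines "L \<equiv> Lambda \<iota>"
  shows "((1 - L\<^sup>2) * F) * ((1 - L\<^sup>2) * F) +
    (scal \<iota> \<i> * (1 + L\<^sup>2) * F) * (scal \<iota> \<i> * (1 + L\<^sup>2) * F) +
    (2 * L * F) * (2 * L * F) = 0"
proof -
  have FL: "F * L = L * F"
    using r_holomorphic_commutes_Lambda[OF assms(1)] by (simp add: L_def)
  then have FL2: "F * L\<^sup>2 = L\<^sup>2 * F"
    by (simp add: power2_eq_square) (metis mult.assoc)
  have square: "(a * F) * (a * F) = a * a * (F * F)" if "F * a = a * F" for a
    using that by (metis mult.assoc)
  have "(scal \<iota> \<i> * (1 + L\<^sup>2) * F) * (scal \<iota> \<i> * (1 + L\<^sup>2) * F) =
      - (((1 + L\<^sup>2) * F) * ((1 + L\<^sup>2) * F))"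
    using scal_mult_mult[of \<i> "(1 + L\<^sup>2) * F" \<i> "(1 + L\<^sup>2) * F"]
    by (simp add: mult.assoc scal_uminus)
  also have "\<dots> = - ((1 + L\<^sup>2) * (1 + L\<^sup>2) * (F * F))"
    by (subst square) (simp_all add: algebra_simps FL2)
  finally have sq2: "(scal \<iota> \<i> * (1 + L\<^sup>2) * F) * (scal \<iota> \<i> * (1 + L\<^sup>2) * F) =
      - ((1 + L\<^sup>2) * (1 + L\<^sup>2) * (F * F))" .
  have sq1: "((1 - L\<^sup>2) * F) * ((1 - L\<^sup>2) * F) = (1 - L\<^sup>2) * (1 - L\<^sup>2) * (F * F)"
    by (rule square) (simp add: algebra_simps FL2)
  \<comment> \<open>The coefficient 4 is spelled out as a sum, so that the final cancellation is
    purely additive.\<close>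
  have sq3: "(2 * L * F) * (2 * L * F) = (L\<^sup>2 + L\<^sup>2 + L\<^sup>2 + L\<^sup>2) * (F * F)"
  proof -
    have L2: "2 * L = L + L" by (simp add: mult_2)
    show ?thesis
      unfolding L2
      by (subst square) (simp_all add: algebra_simps FL power2_eq_square)
  qed
  show ?thesis
    unfolding sq1 sq2 sq3 by (simp add: algebra_simps)
qed

end

theorem theorem2p10:
  fixes hbar :: real
    and \<iota> :: "free_algebra \<Rightarrow> 'f::division_ring"
    and F :: 'f
    and \<Phi> P :: "'f ^ 3"
    and x :: "real ^ 3"
  assumes "weyl_skew_field hbar \<iota>"
    and "r_holomorphic hbar \<iota> F"
    and "\<Phi> $ 1 = (1 - (Lambda \<iota>)\<^sup>2) * F"
    and "\<Phi> $ 2 = scal \<iota> \<i> * (1 + (Lambda \<iota>)\<^sup>2) * F"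
    and "\<Phi> $ 3 = 2 * Lambda \<iota> * F"
    and "\<forall>i. integrable_elt hbar \<iota> (\<Phi> $ i)"
    and "\<forall>i. is_primitive hbar \<iota> (P $ i) (\<Phi> $ i)"
  shows "nc_minimal_surface hbar \<iota>
    (\<chi> i. scal \<iota> (of_real (x $ i)) + re_part \<iota> (P $ i))"
proof -
  interpret weyl_skew_field hbar \<iota> by fact
  have "(\<Sum>i\<in>UNIV. \<Phi> $ i * \<Phi> $ i) = 0"
    using weierstrass_isotropic[OF assms(2)] by (simp add: sum_3 assms(3-5))
  \<comment> \<open>The real translation vector is coerced entrywise to a complex one.\<close>
  then show ?thesis
    using nc_minimal_surface_re_part_primitive[of "\<chi> i. of_real (x $ i)" P \<Phi>] assms(7) by simp
qed

end
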